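(* Let $(A_n)_{n\ge 0}$ and $(B_n)_{n\ge 0}$ be binomial bimonoids in a $\mathbb{Q}_{\ge 0}$-linear symmetric monoidal category $(\mathsf{C},\otimes,I)$. Suppose that the graded object $(A_n)$ is isomorphic to $(B_n)$ in $\mathsf{C}^{\mathbb{N}}$. Then $(A_n)$ and $(B_n)$ are isomorphic as binomial bimonoids.
   Context: Conventions. $f;g$ denotes composition in diagrammatic order (first $f$, then $g$); $\otimes$ binds tighter than $;$. Symmetric monoidal categories are treated as strict. $\gamma_{A,B}:A\otimes B\to B\otimes A$ is the symmetry. A $\mathbb{Q}_{\ge 0}$-linear symmetric monoidal category is a symmetric monoidal category in which every hom-set is a module over the commutative semiring $\mathbb{Q}_{\ge 0}$, and composition and $\otimes$ of morphisms are $\mathbb{Q}_{\ge 0}$-bilinear (in particular preserve $0$ in each variable). A graded object is a family $(A_n)_{n\ge 0}\in\mathsf{C}^{\mathbb{N}}$; morphisms in $\mathsf{C}^{\mathbb{N}}$ are arbitrary families $(f_n:A_n\to B_n)_{n\ge 0}$. A binomial bimonoid is a graded object $(A_n)_{n\ge 0}$ with maps $\nabla_{n,p}:A_n\otimes A_p\to A_{n+p}$, $\Delta_{n,p}:A_{n+p}\to A_n\otimes A_p$, $\eta:I\to A_0$, $\epsilon:A_0\to I$ such that for all $n,p,q,r\ge 0$: (i) $\eta\otimes\mathsf{id}_{A_n};\nabla_{0,n}=\mathsf{id}_{A_n}$; (ii) $\nabla_{n,p}\otimes\mathsf{id}_{A_q};\nabla_{n+p,q}=\mathsf{id}_{A_n}\otimes\nabla_{p,q};\nabla_{n,p+q}$;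 (iii) $\gamma_{A_n,A_p};\nabla_{p,n}=\nabla_{n,p}$; (iv) $\Delta_{0,n};\epsilon\otimes\mathsf{id}_{A_n}=\mathsf{id}_{A_n}$; (v) $\Delta_{n+p,q};\Delta_{n,p}\otimes\mathsf{id}_{A_q}=\Delta_{n,p+q};\mathsf{id}_{A_n}\otimes\Delta_{p,q}$; (vi) $\Delta_{n,p};\gamma_{A_n,A_p}=\Delta_{p,n}$; (vii) $\nabla_{0,0};\epsilon=\epsilon\otimes\epsilon$; (viii) $\eta;\Delta_{0,0}=\eta\otimes\eta$; (ix) $\eta;\epsilon=\mathsf{id}_I$; (x) whenever $n+p=q+r$, $\nabla_{n,p};\Delta_{q,r}=\sum\Delta_{a,b}\otimes\Delta_{c,d};\mathsf{id}_{A_a}\otimes\gamma_{A_b,A_c}\otimes\mathsf{id}_{A_d};\nabla_{a,c}\otimes\nabla_{b,d}$, sum over $a,b,c,d\ge 0$ with $a+b=n$, $c+d=p$, $a+c=q$, $b+d=r$; (xi) $\epsilon;\eta=\mathsf{id}_{A_0}$; (xii) $\Delta_{n,p};\nabla_{n,p}=\binom{n+p}{n}\mathsf{id}_{A_{n+p}}$. A morphism of binomial bimonoids $(A_n)\to(B_n)$ is a family $(f_n:A_n\to B_n)_{n\ge 0}$ with $\eta;f_0=\eta$, $f_0;\epsilon=\epsilon$, $f_n\otimes f_p;\nabla_{n,p}=\nabla_{n,p};f_{n+p}$ and $\Delta_{n,p};f_n\otimes f_p=f_{n+p};\Delta_{n,p}$ for all $n,p\ge 0$; composition and identities are componentwise,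 and isomorphism of binomial bimonoids means isomorphism in the resulting category. *)

theory Defs
  imports Complex_Main "HOL-Algebra.FiniteProduct"
begin

text \<open>
  Categories are given by a carrier of objects and hom-sets between them. Hom-sets need not be
  disjoint, so that families of morphisms can serve as morphisms between structured objects without
  carrying their source and target along; a family with disjoint hom-sets is a special case.
  Composition is written in diagrammatic order.
\<close>

record ('o, 'm) category =
  Obj :: "'o set"
  Hom :: "'o \<Rightarrow> 'o \<Rightarrow> 'm set"
  Id :: "'o \<Rightarrow> 'm" (\<open>\<i>\<d>\<index>\<close>)
  Comp :: "'m \<Rightarrow> 'm \<Rightarrow> 'm" (infixl \<open>;;\<index>\<close> 65)

locale category =
  fixes C :: "('o, 'm, 'z) category_scheme" (structure)
  assumes hom_obj: "f \<in> Hom C X Y \<Longrightarrow> X \<in> Obj C \<and> Y \<in> Obj C"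
    and id_hom: "X \<in> Obj C \<Longrightarrow> \<i>\<d> X \<in> Hom C X X"
    and comp_hom: "f \<in> Hom C X Y \<Longrightarrow> g \<in> Hom C Y Z \<Longrightarrow> f ;; g \<in> Hom C X Z"
    and id_left: "f \<in> Hom C X Y \<Longrightarrow> \<i>\<d> X ;; f = f"
    and id_right: "f \<in> Hom C X Y \<Longrightarrow> f ;; \<i>\<d> Y = f"
    and comp_assoc: "f \<in> Hom C W X \<Longrightarrow> g \<in> Hom C X Y \<Longrightarrow> h \<in> Hom C Y Z \<Longrightarrow>
      (f ;; g) ;; h = f ;; (g ;; h)"

definition isomorphic :: "('o, 'm, 'z) category_scheme \<Rightarrow> 'o \<Rightarrow> 'o \<Rightarrow> bool" where
  "isomorphic C X Y \<longleftrightarrow> X \<in> Obj C \<and> Y \<in> Obj C \<and>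
    (\<exists>f \<in> Hom C X Y. \<exists>g \<in> Hom C Y X.
      f ;;\<^bsub>C\<^esub> g = \<i>\<d>\<^bsub>C\<^esub> X \<and> g ;;\<^bsub>C\<^esub> f = \<i>\<d>\<^bsub>C\<^esub> Y)"

record ('o, 'm) symmetric_monoidal_category = "('o, 'm) category" +
  TensorObj :: "'o \<Rightarrow> 'o \<Rightarrow> 'o" (infixr \<open>\<boxdot>\<index>\<close> 75)
  Unit :: "'o" (\<open>\<I>\<index>\<close>)
  Tensor :: "'m \<Rightarrow> 'm \<Rightarrow> 'm" (infixr \<open>\<boxtimes>\<index>\<close> 75)
  Sym :: "'o \<Rightarrow> 'o \<Rightarrow> 'm" (\<open>\<gamma>\<index>\<close>)

text \<open>
  Strictness: the associator and the unitors are identities, so they become equations between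
  objects together with their naturality (equations between morphisms).
\<close>

locale strict_symmetric_monoidal_category = category C
  for C :: "('o, 'm, 'z) symmetric_monoidal_category_scheme" (structure) +
  assumes unit_obj: "\<I> \<in> Obj C"
    and tensor_obj: "X \<in> Obj C \<Longrightarrow> Y \<in> Obj C \<Longrightarrow> X \<boxdot> Y \<in> Obj C"
    and tensor_obj_assoc: "X \<in> Obj C \<Longrightarrow> Y \<in> Obj C \<Longrightarrow> Z \<in> Obj C \<Longrightarrow>
      (X \<boxdot> Y) \<boxdot> Z = X \<boxdot> (Y \<boxdot> Z)"
    and tensor_obj_unit_left: "X \<in> Obj C \<Longrightarrow> \<I> \<boxdot> X = X"
    and tensor_obj_unit_right: "X \<in> Obj C \<Longrightarrow> X \<boxdot> \<I> = X"
    and tensor_hom: "f \<in> Hom C X Y \<Longrightarrow> g \<in> Hom C X' Y' \<Longrightarrow>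
      f \<boxtimes> g \<in> Hom C (X \<boxdot> X') (Y \<boxdot> Y')"
    and tensor_id: "X \<in> Obj C \<Longrightarrow> Y \<in> Obj C \<Longrightarrow> \<i>\<d> X \<boxtimes> \<i>\<d> Y = \<i>\<d> (X \<boxdot> Y)"
    and tensor_comp: "f \<in> Hom C X Y \<Longrightarrow> g \<in> Hom C Y Z \<Longrightarrow>
      f' \<in> Hom C X' Y' \<Longrightarrow> g' \<in> Hom C Y' Z' \<Longrightarrow>
      (f ;; g) \<boxtimes> (f' ;; g') = f \<boxtimes> f' ;; g \<boxtimes> g'"
    and tensor_assoc: "f \<in> Hom C X X' \<Longrightarrow> g \<in> Hom C Y Y' \<Longrightarrow> h \<in> Hom C Z Z' \<Longrightarrow>
      (f \<boxtimes> g) \<boxtimes> h = f \<boxtimes> (g \<boxtimes> h)"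
    and tensor_unit_left: "f \<in> Hom C X Y \<Longrightarrow> \<i>\<d> \<I> \<boxtimes> f = f"
    and tensor_unit_right: "f \<in> Hom C X Y \<Longrightarrow> f \<boxtimes> \<i>\<d> \<I> = f"
    and sym_hom: "X \<in> Obj C \<Longrightarrow> Y \<in> Obj C \<Longrightarrow> \<gamma> X Y \<in> Hom C (X \<boxdot> Y) (Y \<boxdot> X)"
    and sym_natural: "f \<in> Hom C X X' \<Longrightarrow> g \<in> Hom C Y Y' \<Longrightarrow>
      f \<boxtimes> g ;; \<gamma> X' Y' = \<gamma> X Y ;; g \<boxtimes> f"
    and sym_inverse: "X \<in> Obj C \<Longrightarrow> Y \<in> Obj C \<Longrightarrow> \<gamma> X Y ;; \<gamma> Y X = \<i>\<d> (X \<boxdot> Y)"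
    and sym_hexagon: "X \<in> Obj C \<Longrightarrow> Y \<in> Obj C \<Longrightarrow> Z \<in> Obj C \<Longrightarrow>
      \<gamma> X (Y \<boxdot> Z) = \<gamma> X Y \<boxtimes> \<i>\<d> Z ;; \<i>\<d> Y \<boxtimes> \<gamma> X Z"
    and sym_unit: "X \<in> Obj C \<Longrightarrow> \<gamma> X \<I> = \<i>\<d> X"

record ('o, 'm) linear_category = "('o, 'm) symmetric_monoidal_category" +
  Add :: "'m \<Rightarrow> 'm \<Rightarrow> 'm" (infixl \<open>\<boxplus>\<index>\<close> 60)
  Zero :: "'o \<Rightarrow> 'o \<Rightarrow> 'm" (\<open>\<O>\<index>\<close>)
  Scale :: "rat \<Rightarrow> 'm \<Rightarrow> 'm" (infixr \<open>\<cdot>\<index>\<close> 70)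

text \<open>
  The additive monoid of a hom-set is a multiplicatively written \<open>monoid\<close> record, so its finite
  sums are \<open>finprod\<close>.
\<close>

definition hom_monoid :: "('o, 'm, 'z) linear_category_scheme \<Rightarrow> 'o \<Rightarrow> 'o \<Rightarrow> 'm monoid" where
  "hom_monoid C X Y = \<lparr>carrier = Hom C X Y, mult = Add C, one = Zero C X Y\<rparr>"

text \<open>Scalars are non-negative rationals: \<open>Scale\<close> is unconstrained on negative arguments.\<close>

locale nonneg_rat_linear_smc = strict_symmetric_monoidal_category C
  for C :: "('o, 'm, 'z) linear_category_scheme" (structure) +
  assumes hom_comm_monoid: "X \<in> Obj C \<Longrightarrow> Y \<in> Obj C \<Longrightarrow> comm_monoid (hom_monoid C X Y)"
    and scale_hom: "0 \<le> r \<Longrightarrow> f \<in> Hom C X Y \<Longrightarrow> r \<cdot> f \<in> Hom C X Y"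
    and scale_add_right: "0 \<le> r \<Longrightarrow> f \<in> Hom C X Y \<Longrightarrow> g \<in> Hom C X Y \<Longrightarrow>
      r \<cdot> (f \<boxplus> g) = r \<cdot> f \<boxplus> r \<cdot> g"
    and scale_zero_right: "0 \<le> r \<Longrightarrow> X \<in> Obj C \<Longrightarrow> Y \<in> Obj C \<Longrightarrow> r \<cdot> \<O> X Y = \<O> X Y"
    and scale_add_left: "0 \<le> r \<Longrightarrow> 0 \<le> s \<Longrightarrow> f \<in> Hom C X Y \<Longrightarrow>
      (r + s) \<cdot> f = r \<cdot> f \<boxplus> s \<cdot> f"
    and scale_zero_left: "f \<in> Hom C X Y \<Longrightarrow> 0 \<cdot> f = \<O> X Y"
    and scale_scale: "0 \<le> r \<Longrightarrow> 0 \<le> s \<Longrightarrow> f \<in> Hom C X Y \<Longrightarrow> (r * s) \<cdot> f = r \<cdot> s \<cdot> f"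
    and scale_one: "f \<in> Hom C X Y \<Longrightarrow> 1 \<cdot> f = f"
    and comp_add_left: "f \<in> Hom C X Y \<Longrightarrow> f' \<in> Hom C X Y \<Longrightarrow> g \<in> Hom C Y Z \<Longrightarrow>
      (f \<boxplus> f') ;; g = f ;; g \<boxplus> f' ;; g"
    and comp_add_right: "f \<in> Hom C X Y \<Longrightarrow> g \<in> Hom C Y Z \<Longrightarrow> g' \<in> Hom C Y Z \<Longrightarrow>
      f ;; (g \<boxplus> g') = f ;; g \<boxplus> f ;; g'"
    and comp_zero_left: "X \<in> Obj C \<Longrightarrow> g \<in> Hom C Y Z \<Longrightarrow> \<O> X Y ;; g = \<O> X Z"
    and comp_zero_right: "f \<in> Hom C X Y \<Longrightarrow> Z \<in> Obj C \<Longrightarrow> f ;; \<O> Y Z = \<O> X Z"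
    and comp_scale_left: "0 \<le> r \<Longrightarrow> f \<in> Hom C X Y \<Longrightarrow> g \<in> Hom C Y Z \<Longrightarrow>
      (r \<cdot> f) ;; g = r \<cdot> (f ;; g)"
    and comp_scale_right: "0 \<le> r \<Longrightarrow> f \<in> Hom C X Y \<Longrightarrow> g \<in> Hom C Y Z \<Longrightarrow>
      f ;; (r \<cdot> g) = r \<cdot> (f ;; g)"
    and tensor_add_left: "f \<in> Hom C X Y \<Longrightarrow> f' \<in> Hom C X Y \<Longrightarrow> g \<in> Hom C X' Y' \<Longrightarrow>
      (f \<boxplus> f') \<boxtimes> g = f \<boxtimes> g \<boxplus> f' \<boxtimes> g"
    and tensor_add_right: "f \<in> Hom C X Y \<Longrightarrow> g \<in> Hom C X' Y' \<Longrightarrow> g' \<in> Hom C X' Y' \<Longrightarrow>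
      f \<boxtimes> (g \<boxplus> g') = f \<boxtimes> g \<boxplus> f \<boxtimes> g'"
    and tensor_zero_left: "X \<in> Obj C \<Longrightarrow> Y \<in> Obj C \<Longrightarrow> g \<in> Hom C X' Y' \<Longrightarrow>
      \<O> X Y \<boxtimes> g = \<O> (X \<boxdot> X') (Y \<boxdot> Y')"
    and tensor_zero_right: "f \<in> Hom C X Y \<Longrightarrow> X' \<in> Obj C \<Longrightarrow> Y' \<in> Obj C \<Longrightarrow>
      f \<boxtimes> \<O> X' Y' = \<O> (X \<boxdot> X') (Y \<boxdot> Y')"
    and tensor_scale_left: "0 \<le> r \<Longrightarrow> f \<in> Hom C X Y \<Longrightarrow> g \<in> Hom C X' Y' \<Longrightarrow>
      (r \<cdot> f) \<boxtimes> g = r \<cdot> (f \<boxtimes> g)"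
    and tensor_scale_right: "0 \<le> r \<Longrightarrow> f \<in> Hom C X Y \<Longrightarrow> g \<in> Hom C X' Y' \<Longrightarrow>
      f \<boxtimes> (r \<cdot> g) = r \<cdot> (f \<boxtimes> g)"

definition graded_category ::
    "('o, 'm, 'z) category_scheme \<Rightarrow> (nat \<Rightarrow> 'o, nat \<Rightarrow> 'm) category" where
  "graded_category C =
    \<lparr>Obj = {A. \<forall>n. A n \<in> Obj C},
     Hom = (\<lambda>A B. {f. \<forall>n. f n \<in> Hom C (A n) (B n)}),
     Id = (\<lambda>A n. \<i>\<d>\<^bsub>C\<^esub> (A n)),
     Comp = (\<lambda>f g n. f n ;;\<^bsub>C\<^esub> g n)\<rparr>"

locale binomial_bimonoid = nonneg_rat_linear_smc C
  for C :: "('o, 'm, 'z) linear_category_scheme" (structure) +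
  fixes A :: "nat \<Rightarrow> 'o"
    and nabla :: "nat \<Rightarrow> nat \<Rightarrow> 'm" (\<open>\<nabla>\<close>)
    and \<Delta> :: "nat \<Rightarrow> nat \<Rightarrow> 'm"
    and \<eta> :: "'m"
    and \<epsilon> :: "'m"
  assumes obj: "A n \<in> Obj C"
    and nabla_hom: "\<nabla> n p \<in> Hom C (A n \<boxdot> A p) (A (n + p))"
    and delta_hom: "\<Delta> n p \<in> Hom C (A (n + p)) (A n \<boxdot> A p)"
    and eta_hom: "\<eta> \<in> Hom C \<I> (A 0)"
    and eps_hom: "\<epsilon> \<in> Hom C (A 0) \<I>"
    and nabla_unit: "\<eta> \<boxtimes> \<i>\<d> (A n) ;; \<nabla> 0 n = \<i>\<d> (A n)"
    and nabla_assoc: "\<nabla> n p \<boxtimes> \<i>\<d> (A q) ;; \<nabla> (n + p) q = \<i>\<d> (A n) \<boxtimes> \<nabla> p q ;; \<nabla> n (p + q)"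
    and nabla_comm: "\<gamma> (A n) (A p) ;; \<nabla> p n = \<nabla> n p"
    and delta_counit: "\<Delta> 0 n ;; \<epsilon> \<boxtimes> \<i>\<d> (A n) = \<i>\<d> (A n)"
    and delta_coassoc: "\<Delta> (n + p) q ;; \<Delta> n p \<boxtimes> \<i>\<d> (A q) = \<Delta> n (p + q) ;; \<i>\<d> (A n) \<boxtimes> \<Delta> p q"
    and delta_cocomm: "\<Delta> n p ;; \<gamma> (A n) (A p) = \<Delta> p n"
    and nabla_eps: "\<nabla> 0 0 ;; \<epsilon> = \<epsilon> \<boxtimes> \<epsilon>"
    and eta_delta: "\<eta> ;; \<Delta> 0 0 = \<eta> \<boxtimes> \<eta>"
    and eta_eps: "\<eta> ;; \<epsilon> = \<i>\<d> \<I>"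
    and nabla_delta: "n + p = q + r \<Longrightarrow>
      \<nabla> n p ;; \<Delta> q r =
        finprod (hom_monoid C (A n \<boxdot> A p) (A q \<boxdot> A r))
          (\<lambda>(a, b, c, d).
            \<Delta> a b \<boxtimes> \<Delta> c d ;; \<i>\<d> (A a) \<boxtimes> \<gamma> (A b) (A c) \<boxtimes> \<i>\<d> (A d) ;; \<nabla> a c \<boxtimes> \<nabla> b d)
          {(a, b, c, d). a + b = n \<and> c + d = p \<and> a + c = q \<and> b + d = r}"
    and eps_eta: "\<epsilon> ;; \<eta> = \<i>\<d> (A 0)"
    and delta_nabla: "\<Delta> n p ;; \<nabla> n p = of_nat ((n + p) choose n) \<cdot> \<i>\<d> (A (n + p))"

type_synonym ('o, 'm) bimonoid_data =
  "(nat \<Rightarrow> 'o) \<times> (nat \<Rightarrow> nat \<Rightarrow> 'm) \<times> (nat \<Rightarrow> nat \<Rightarrow> 'm) \<times> 'm \<times> 'm"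

definition binomial_bimonoids ::
    "('o, 'm, 'z) linear_category_scheme \<Rightarrow> ('o, 'm) bimonoid_data set" where
  "binomial_bimonoids C = {(A, nabla, \<Delta>, \<eta>, \<epsilon>). binomial_bimonoid C A nabla \<Delta> \<eta> \<epsilon>}"

fun bimonoid_morphism ::
    "('o, 'm, 'z) linear_category_scheme \<Rightarrow> ('o, 'm) bimonoid_data \<Rightarrow> ('o, 'm) bimonoid_data \<Rightarrow>
      (nat \<Rightarrow> 'm) \<Rightarrow> bool" where
  "bimonoid_morphism C (A, nablaA, \<Delta>A, \<eta>A, \<epsilon>A) (B, nablaB, \<Delta>B, \<eta>B, \<epsilon>B) f \<longleftrightarrow>
    (\<forall>n. f n \<in> Hom C (A n) (B n)) \<and>
    \<eta>A ;;\<^bsub>C\<^esub> f 0 = \<eta>B \<and>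
    f 0 ;;\<^bsub>C\<^esub> \<epsilon>B = \<epsilon>A \<and>
    (\<forall>n p. f n \<boxtimes>\<^bsub>C\<^esub> f p ;;\<^bsub>C\<^esub> nablaB n p = nablaA n p ;;\<^bsub>C\<^esub> f (n + p)) \<and>
    (\<forall>n p. \<Delta>A n p ;;\<^bsub>C\<^esub> f n \<boxtimes>\<^bsub>C\<^esub> f p = f (n + p) ;;\<^bsub>C\<^esub> \<Delta>B n p)"

definition binomial_bimonoid_category ::
    "('o, 'm, 'z) linear_category_scheme \<Rightarrow> (('o, 'm) bimonoid_data, nat \<Rightarrow> 'm) category" where
  "binomial_bimonoid_category C =
    \<lparr>Obj = binomial_bimonoids C,
     Hom = (\<lambda>M N. {f. M \<in> binomial_bimonoids C \<and> N \<in> binomial_bimonoids C \<and>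
       bimonoid_morphism C M N f}),
     Id = (\<lambda>(A, _) n. \<i>\<d>\<^bsub>C\<^esub> (A n)),
     Comp = (\<lambda>f g n. f n ;;\<^bsub>C\<^esub> g n)\<rparr>"

lemma (in category) category_graded: "category (graded_category C)"
  by unfold_locales
    (auto simp: graded_category_def fun_eq_iff
      intro: hom_obj id_hom comp_hom id_left id_right comp_assoc dest: hom_obj)

lemma (in nonneg_rat_linear_smc) bimonoid_morphism_id:
  assumes "M \<in> binomial_bimonoids C"
  shows "bimonoid_morphism C M M (\<lambda>n. \<i>\<d> (fst M n))"
proof -
  obtain A m d u e where M: "M = (A, m, d, u, e)" by (cases M)
  interpret binomial_bimonoid C A m d u e
    using assms by (simp add: M binomial_bimonoids_def)
  show ?thesis
    by (simp add: M obj id_hom tensor_id id_right[OF eta_hom] id_left[OF eps_hom]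
        id_left[OF nabla_hom] id_right[OF nabla_hom] id_left[OF delta_hom] id_right[OF delta_hom])
qed

lemma (in nonneg_rat_linear_smc) bimonoid_morphism_comp:
  assumes "L \<in> binomial_bimonoids C" "M \<in> binomial_bimonoids C" "N \<in> binomial_bimonoids C"
    and "bimonoid_morphism C L M f" "bimonoid_morphism C M N g"
  shows "bimonoid_morphism C L N (\<lambda>n. f n ;; g n)"
proof -
  obtain A1 m1 d1 u1 e1 where L: "L = (A1, m1, d1, u1, e1)" by (cases L)
  obtain A2 m2 d2 u2 e2 where M: "M = (A2, m2, d2, u2, e2)" by (cases M)
  obtain A3 m3 d3 u3 e3 where N: "N = (A3, m3, d3, u3, e3)" by (cases N)
  interpret L: binomial_bimonoid C A1 m1 d1 u1 e1
    using assms by (simp add: L binomial_bimonoids_def)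
  interpret M: binomial_bimonoid C A2 m2 d2 u2 e2
    using assms by (simp add: M binomial_bimonoids_def)
  interpret N: binomial_bimonoid C A3 m3 d3 u3 e3
    using assms by (simp add: N binomial_bimonoids_def)
  have f: "f n \<in> Hom C (A1 n) (A2 n)" and g: "g n \<in> Hom C (A2 n) (A3 n)" for n
    using assms by (auto simp: L M N)
  have ff: "f n \<boxtimes> f p \<in> Hom C (A1 n \<boxdot> A1 p) (A2 n \<boxdot> A2 p)"
    and gg: "g n \<boxtimes> g p \<in> Hom C (A2 n \<boxdot> A2 p) (A3 n \<boxdot> A3 p)" for n p
    by (simp_all add: tensor_hom f g)
  have eqs: "u1 ;; f 0 = u2" "u2 ;; g 0 = u3" "f 0 ;; e2 = e1" "g 0 ;; e3 = e2"
    and m: "f n \<boxtimes> f p ;; m2 n p = m1 n p ;; f (n + p)"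
      "g n \<boxtimes> g p ;; m3 n p = m2 n p ;; g (n + p)"
    and d: "d1 n p ;; f n \<boxtimes> f p = f (n + p) ;; d2 n p"
      "d2 n p ;; g n \<boxtimes> g p = g (n + p) ;; d3 n p" for n p
    using assms by (auto simp: L M N)
  have "u1 ;; (f 0 ;; g 0) = u3"
    by (metis comp_assoc L.eta_hom f g eqs(1,2))
  moreover have "(f 0 ;; g 0) ;; e3 = e1"
    by (metis comp_assoc N.eps_hom f g eqs(3,4))
  moreover have "(f n ;; g n) \<boxtimes> (f p ;; g p) ;; m3 n p = m1 n p ;; (f (n + p) ;; g (n + p))" for n p
    using comp_assoc[OF ff gg N.nabla_hom] comp_assoc[OF ff M.nabla_hom g]
      comp_assoc[OF L.nabla_hom f g] by (simp add: tensor_comp[OF f g f g] m)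
  moreover have "d1 n p ;; (f n ;; g n) \<boxtimes> (f p ;; g p) = (f (n + p) ;; g (n + p)) ;; d3 n p" for n p
    using comp_assoc[OF L.delta_hom ff gg] comp_assoc[OF f M.delta_hom gg]
      comp_assoc[OF f g N.delta_hom] by (simp add: tensor_comp[OF f g f g] d)
  ultimately show ?thesis
    by (simp add: L N comp_hom[OF f g])
qed

lemma bimonoid_morphism_hom: "bimonoid_morphism C M N f \<Longrightarrow> f n \<in> Hom C (fst M n) (fst N n)"
  by (cases M; cases N) auto

lemma (in nonneg_rat_linear_smc) category_binomial_bimonoid:
  "category (binomial_bimonoid_category C)"
proof unfold_locales
  fix f g h W X Y Z
  note [simp] = binomial_bimonoid_category_def split_beta
  let ?B = "binomial_bimonoid_category C"
  show "f \<in> Hom ?B X Y \<Longrightarrow> X \<in> Obj ?B \<and> Y \<in> Obj ?B" by simp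
  show "X \<in> Obj ?B \<Longrightarrow> \<i>\<d>\<^bsub>?B\<^esub> X \<in> Hom ?B X X"
    using bimonoid_morphism_id[of X] by simp
  show "f \<in> Hom ?B X Y \<Longrightarrow> g \<in> Hom ?B Y Z \<Longrightarrow> f ;;\<^bsub>?B\<^esub> g \<in> Hom ?B X Z"
    using bimonoid_morphism_comp[of X Y Z f g] by simp
  show "f \<in> Hom ?B X Y \<Longrightarrow> \<i>\<d>\<^bsub>?B\<^esub> X ;;\<^bsub>?B\<^esub> f = f"
    by (auto intro!: ext id_left dest: bimonoid_morphism_hom)
  show "f \<in> Hom ?B X Y \<Longrightarrow> f ;;\<^bsub>?B\<^esub> \<i>\<d>\<^bsub>?B\<^esub> Y = f"
    by (auto intro!: ext id_right dest: bimonoid_morphism_hom)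
  show "f \<in> Hom ?B W X \<Longrightarrow> g \<in> Hom ?B X Y \<Longrightarrow> h \<in> Hom ?B Y Z \<Longrightarrow>
      (f ;;\<^bsub>?B\<^esub> g) ;;\<^bsub>?B\<^esub> h = f ;;\<^bsub>?B\<^esub> (g ;;\<^bsub>?B\<^esub> h)"
    by (auto intro!: ext comp_assoc dest: bimonoid_morphism_hom)
qed

end

theory Submission
  imports Defs
begin

text \<open>
  Only the degree \<open>1\<close> component \<open>u : A\<^sub>1 \<rightarrow> B\<^sub>1\<close> of the graded isomorphism matters. It extends to a
  morphism of bimonoids by \<open>f\<^sub>0 = \<epsilon>; \<eta>\<close> and \<open>(n+1) f\<^sub>n\<^sub>+\<^sub>1 = \<Delta>\<^sub>n\<^sub>,\<^sub>1; f\<^sub>n \<otimes> u; \<nabla>\<^sub>n\<^sub>,\<^sub>1\<close>.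
  The bialgebra law for \<open>\<nabla>\<^sub>n\<^sub>,\<^sub>1; \<Delta>\<^sub>n\<^sub>,\<^sub>1\<close> has two summands, the identity and
  \<open>\<Delta> \<otimes> id; id \<otimes> \<gamma>; \<nabla> \<otimes> id\<close>. In \<open>(n+1) f\<^sub>n\<^sub>+\<^sub>1; \<Delta>\<^sub>n\<^sub>,\<^sub>1\<close> the first contributes \<open>\<Delta>\<^sub>n\<^sub>,\<^sub>1; f\<^sub>n \<otimes> u\<close>, and
  by induction and cocommutativity the second contributes \<open>n\<close> times the same morphism; dually for \<open>\<nabla>\<close>.
  Coassociativity extends compatibility from \<open>\<Delta>\<^sub>n\<^sub>,\<^sub>1\<close> to all \<open>\<Delta>\<^sub>n\<^sub>,\<^sub>p\<close>, because \<open>\<Delta>\<^sub>p\<^sub>,\<^sub>1\<close> is split monic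
  up to the invertible scalar \<open>p+1\<close>. A morphism is determined by its degree \<open>1\<close> component, so
  the extensions of \<open>u\<close> and \<open>u\<close>'s inverse are mutually inverse.
\<close>

section \<open>Rules for the symmetry, scalars and interchange in the ambient category\<close>

context nonneg_rat_linear_smc
begin

text \<open>The axioms fix the symmetry only for a unit on the right. Here
  \<open>\<gamma> \<I> X\<close> is inverse to \<open>\<gamma> X \<I>\<close>, which is an
  identity.\<close>

lemma sym_unit_left: "X \<in> Obj C \<Longrightarrow> \<gamma> \<I> X = \<i>\<d> X"
  by (metis id_left sym_hom sym_inverse sym_unit tensor_obj_unit_left tensor_obj_unit_right unit_obj)

text \<open>Multiplying by \<open>inverse r\<close> undoes the scaling. Hom-sets have no
  subtraction, so every later division goes through this cancellation.\<close>

lemma scale_inverse_eq: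
  assumes "f \<in> Hom C X Y" "g \<in> Hom C X Y" "0 < r" "r \<cdot> f = r \<cdot> g"
  shows "f = g"
proof -
  have "inverse r \<cdot> r \<cdot> h = h" if "h \<in> Hom C X Y" for h
    using scale_scale[OF _ _ that, of "inverse r" r] assms(3) by (simp add: scale_one[OF that])
  then show ?thesis using assms by metis
qed

text \<open>This and the next three lemmas are interchange with one identity factor. The suffix
  names the tensor factor in which a composite remains; the prefix \<open>tensor_comp\<close> or
  \<open>comp_tensor\<close> tells whether the identity sits in the second or in the first
  map.\<close>

lemma tensor_comp_right:
  assumes "f \<in> Hom C X Y" "g \<in> Hom C X' Y'" "g' \<in> Hom C Y' Z'"
  shows "f \<boxtimes> g ;; \<i>\<d> Y \<boxtimes> g' = f \<boxtimes> (g ;; g')"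
  using tensor_comp[OF assms(1) id_hom assms(2,3)] hom_obj[OF assms(1)] id_right[OF assms(1)] by simp

lemma tensor_comp_left:
  assumes "f \<in> Hom C X Y" "f' \<in> Hom C Y Z" "g \<in> Hom C X' Y'"
  shows "f \<boxtimes> g ;; f' \<boxtimes> \<i>\<d> Y' = (f ;; f') \<boxtimes> g"
  using tensor_comp[OF assms(1,2) assms(3) id_hom] hom_obj[OF assms(3)] id_right[OF assms(3)] by simp

lemma comp_tensor_right:
  assumes "f \<in> Hom C X Y" "g \<in> Hom C X' Y'" "g' \<in> Hom C Y' Z'"
  shows "\<i>\<d> X \<boxtimes> g ;; f \<boxtimes> g' = f \<boxtimes> (g ;; g')"
  using tensor_comp[OF id_hom assms(1) assms(2,3)] hom_obj[OF assms(1)] id_left[OF assms(1)] by simp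

lemma comp_tensor_left:
  assumes "f \<in> Hom C X Y" "f' \<in> Hom C Y Z" "g \<in> Hom C X' Y'"
  shows "f \<boxtimes> \<i>\<d> X' ;; f' \<boxtimes> g = (f ;; f') \<boxtimes> g"
  using tensor_comp[OF assms(1,2) id_hom assms(3)] hom_obj[OF assms(3)] id_left[OF assms(3)] by simp

lemma comp_assoc3:
  assumes "f \<in> Hom C V W" "g \<in> Hom C W X" "h \<in> Hom C X Y" "k \<in> Hom C Y Z"
  shows "f ;; (g ;; h ;; k) = f ;; g ;; h ;; k"
  using comp_assoc[OF assms(1) comp_hom[OF assms(2,3)] assms(4)] comp_assoc[OF assms(1-3)] by simp

section \<open>Diagram chases behind the inductions, stated for abstract objects and maps\<close>

lemma swap_last_two:
  assumes f: "f \<in> Hom C Q Q'" and u: "u \<in> Hom C Y Y'"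
  shows "f \<boxtimes> u \<boxtimes> u ;; \<i>\<d> Q' \<boxtimes> \<gamma> Y' Y' = \<i>\<d> Q \<boxtimes> \<gamma> Y Y ;; f \<boxtimes> u \<boxtimes> u"
proof -
  have [simp]: "Y \<in> Obj C" "Y' \<in> Obj C" using hom_obj u by auto
  show ?thesis
    using tensor_comp_right[OF f tensor_hom[OF u u] sym_hom]
      comp_tensor_right[OF f sym_hom tensor_hom[OF u u]] sym_natural[OF u u] by simp
qed

text \<open>Evaluates the swap summand of the bialgebra law. By \<open>eq\<close>, the map
  \<open>d'\<close> moves in front of \<open>F\<close> and becomes \<open>d\<close>; the swap then
  slides forward past \<open>u \<boxtimes> u\<close> by naturality and is absorbed by
  \<open>cocomm\<close>. In use, \<open>D\<close> and \<open>d\<close> are two successive splittings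
  of a degree 1 factor, and \<open>eq\<close> is the induction hypothesis.\<close>

lemma comul_step:
  assumes D: "D \<in> Hom C Z (P \<boxdot> Y)" and d: "d \<in> Hom C P (Q \<boxdot> Y)"
    and cocomm: "D ;; d \<boxtimes> \<i>\<d> Y ;; \<i>\<d> Q \<boxtimes> \<gamma> Y Y = D ;; d \<boxtimes> \<i>\<d> Y"
    and F: "F \<in> Hom C P P'" and f: "f \<in> Hom C Q Q'" and u: "u \<in> Hom C Y Y'"
    and d': "d' \<in> Hom C P' (Q' \<boxdot> Y')" and m': "m' \<in> Hom C (Q' \<boxdot> Y') P'"
    and eq: "F ;; d' = d ;; f \<boxtimes> u"
  shows "D ;; F \<boxtimes> u ;; (d' \<boxtimes> \<i>\<d> Y' ;; \<i>\<d> Q' \<boxtimes> \<gamma> Y' Y' ;; m' \<boxtimes> \<i>\<d> Y') = D ;; (d ;; f \<boxtimes> u ;; m') \<boxtimes> u"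
proof -
  have [simp]: "Y \<in> Obj C" "Y' \<in> Obj C" "Q \<in> Obj C" "Q' \<in> Obj C" using hom_obj f u by auto
  have Fu: "F \<boxtimes> u \<in> Hom C (P \<boxdot> Y) (P' \<boxdot> Y')" by (intro tensor_hom F u)
  have dY: "d \<boxtimes> \<i>\<d> Y \<in> Hom C (P \<boxdot> Y) (Q \<boxdot> Y \<boxdot> Y)"
    using tensor_hom[OF d id_hom] by (simp add: tensor_obj_assoc)
  have dY': "d' \<boxtimes> \<i>\<d> Y' \<in> Hom C (P' \<boxdot> Y') (Q' \<boxdot> Y' \<boxdot> Y')"
    using tensor_hom[OF d' id_hom] by (simp add: tensor_obj_assoc)
  have mY': "m' \<boxtimes> \<i>\<d> Y' \<in> Hom C (Q' \<boxdot> Y' \<boxdot> Y') (P' \<boxdot> Y')"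
    using tensor_hom[OF m' id_hom] by (simp add: tensor_obj_assoc)
  have s: "\<i>\<d> Q \<boxtimes> \<gamma> Y Y \<in> Hom C (Q \<boxdot> Y \<boxdot> Y) (Q \<boxdot> Y \<boxdot> Y)"
    and s': "\<i>\<d> Q' \<boxtimes> \<gamma> Y' Y' \<in> Hom C (Q' \<boxdot> Y' \<boxdot> Y') (Q' \<boxdot> Y' \<boxdot> Y')"
    by (simp_all add: tensor_hom id_hom sym_hom)
  have fuu: "f \<boxtimes> u \<boxtimes> u \<in> Hom C (Q \<boxdot> Y \<boxdot> Y) (Q' \<boxdot> Y' \<boxdot> Y')" by (intro tensor_hom f u)
  have fu: "f \<boxtimes> u \<in> Hom C (Q \<boxdot> Y) (Q' \<boxdot> Y')" by (intro tensor_hom f u)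
  note Ddy = comp_hom[OF D dY]
  have 1: "F \<boxtimes> u ;; d' \<boxtimes> \<i>\<d> Y' = d \<boxtimes> \<i>\<d> Y ;; f \<boxtimes> u \<boxtimes> u"
    using tensor_comp_left[OF F d' u] comp_tensor_left[OF d fu u] eq tensor_assoc[OF f u u] by simp
  have 2: "d \<boxtimes> \<i>\<d> Y ;; f \<boxtimes> u \<boxtimes> u ;; m' \<boxtimes> \<i>\<d> Y' = (d ;; f \<boxtimes> u ;; m') \<boxtimes> u"
    using tensor_comp_left[OF comp_hom[OF d fu] m' u] comp_tensor_left[OF d fu u]
      tensor_assoc[OF f u u] by simp
  have "D ;; F \<boxtimes> u ;; (d' \<boxtimes> \<i>\<d> Y' ;; \<i>\<d> Q' \<boxtimes> \<gamma> Y' Y' ;; m' \<boxtimes> \<i>\<d> Y')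
      = D ;; (F \<boxtimes> u ;; d' \<boxtimes> \<i>\<d> Y') ;; \<i>\<d> Q' \<boxtimes> \<gamma> Y' Y' ;; m' \<boxtimes> \<i>\<d> Y'"
    by (metis comp_assoc3[OF comp_hom[OF D Fu] dY' s' mY'] comp_assoc[OF D Fu dY'])
  also have "\<dots> = D ;; d \<boxtimes> \<i>\<d> Y ;; (f \<boxtimes> u \<boxtimes> u ;; \<i>\<d> Q' \<boxtimes> \<gamma> Y' Y') ;; m' \<boxtimes> \<i>\<d> Y'"
    unfolding 1 by (metis comp_assoc[OF D dY fuu] comp_assoc[OF Ddy fuu s'])
  also have "\<dots> = (D ;; d \<boxtimes> \<i>\<d> Y ;; \<i>\<d> Q \<boxtimes> \<gamma> Y Y) ;; f \<boxtimes> u \<boxtimes> u ;; m' \<boxtimes> \<i>\<d> Y'"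
    unfolding swap_last_two[OF f u] by (metis comp_assoc[OF Ddy s fuu])
  also have "\<dots> = D ;; (d \<boxtimes> \<i>\<d> Y ;; f \<boxtimes> u \<boxtimes> u ;; m' \<boxtimes> \<i>\<d> Y')"
    unfolding cocomm by (metis comp_assoc3[OF D dY fuu mY'])
  finally show ?thesis unfolding 2 .
qed

text \<open>Dual of \<open>comul_step\<close>: \<open>eq\<close> moves the multiplication behind
  \<open>F\<close>, and the swap slides backward past \<open>u \<boxtimes> u\<close> until
  \<open>comm\<close> absorbs it into \<open>M\<close>.\<close>

lemma mul_step:
  assumes M: "M \<in> Hom C (P' \<boxdot> Y') Z" and m': "m' \<in> Hom C (Q' \<boxdot> Y') P'"
    and comm: "\<i>\<d> Q' \<boxtimes> \<gamma> Y' Y' ;; (m' \<boxtimes> \<i>\<d> Y' ;; M) = m' \<boxtimes> \<i>\<d> Y' ;; M"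
    and F: "F \<in> Hom C P P'" and f: "f \<in> Hom C Q Q'" and u: "u \<in> Hom C Y Y'"
    and d: "d \<in> Hom C P (Q \<boxdot> Y)" and m: "m \<in> Hom C (Q \<boxdot> Y) P"
    and eq: "m ;; F = f \<boxtimes> u ;; m'"
  shows "d \<boxtimes> \<i>\<d> Y ;; \<i>\<d> Q \<boxtimes> \<gamma> Y Y ;; m \<boxtimes> \<i>\<d> Y ;; (F \<boxtimes> u ;; M) = (d ;; f \<boxtimes> u ;; m') \<boxtimes> u ;; M"
proof -
  have [simp]: "Y \<in> Obj C" "Y' \<in> Obj C" "Q \<in> Obj C" "Q' \<in> Obj C" using hom_obj f u by auto
  have Fu: "F \<boxtimes> u \<in> Hom C (P \<boxdot> Y) (P' \<boxdot> Y')" by (intro tensor_hom F u)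
  have dY: "d \<boxtimes> \<i>\<d> Y \<in> Hom C (P \<boxdot> Y) (Q \<boxdot> Y \<boxdot> Y)"
    using tensor_hom[OF d id_hom] by (simp add: tensor_obj_assoc)
  have mY: "m \<boxtimes> \<i>\<d> Y \<in> Hom C (Q \<boxdot> Y \<boxdot> Y) (P \<boxdot> Y)"
    using tensor_hom[OF m id_hom] by (simp add: tensor_obj_assoc)
  have mY': "m' \<boxtimes> \<i>\<d> Y' \<in> Hom C (Q' \<boxdot> Y' \<boxdot> Y') (P' \<boxdot> Y')"
    using tensor_hom[OF m' id_hom] by (simp add: tensor_obj_assoc)
  have s: "\<i>\<d> Q \<boxtimes> \<gamma> Y Y \<in> Hom C (Q \<boxdot> Y \<boxdot> Y) (Q \<boxdot> Y \<boxdot> Y)"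
    and s': "\<i>\<d> Q' \<boxtimes> \<gamma> Y' Y' \<in> Hom C (Q' \<boxdot> Y' \<boxdot> Y') (Q' \<boxdot> Y' \<boxdot> Y')"
    by (simp_all add: tensor_hom id_hom sym_hom)
  have fuu: "f \<boxtimes> u \<boxtimes> u \<in> Hom C (Q \<boxdot> Y \<boxdot> Y) (Q' \<boxdot> Y' \<boxdot> Y')" by (intro tensor_hom f u)
  have fu: "f \<boxtimes> u \<in> Hom C (Q \<boxdot> Y) (Q' \<boxdot> Y')" by (intro tensor_hom f u)
  note ds = comp_hom[OF dY s]
  have 1: "m \<boxtimes> \<i>\<d> Y ;; F \<boxtimes> u = f \<boxtimes> u \<boxtimes> u ;; m' \<boxtimes> \<i>\<d> Y'"
    using comp_tensor_left[OF m F u] tensor_comp_left[OF fu m' u] eq tensor_assoc[OF f u u] by simp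
  have 2: "d \<boxtimes> \<i>\<d> Y ;; f \<boxtimes> u \<boxtimes> u ;; m' \<boxtimes> \<i>\<d> Y' = (d ;; f \<boxtimes> u ;; m') \<boxtimes> u"
    using tensor_comp_left[OF comp_hom[OF d fu] m' u] comp_tensor_left[OF d fu u]
      tensor_assoc[OF f u u] by simp
  have "d \<boxtimes> \<i>\<d> Y ;; \<i>\<d> Q \<boxtimes> \<gamma> Y Y ;; m \<boxtimes> \<i>\<d> Y ;; (F \<boxtimes> u ;; M)
      = d \<boxtimes> \<i>\<d> Y ;; \<i>\<d> Q \<boxtimes> \<gamma> Y Y ;; (m \<boxtimes> \<i>\<d> Y ;; F \<boxtimes> u) ;; M"
    by (metis comp_assoc[OF comp_hom[OF ds mY] Fu M] comp_assoc[OF ds mY Fu])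
  also have "\<dots> = d \<boxtimes> \<i>\<d> Y ;; (\<i>\<d> Q \<boxtimes> \<gamma> Y Y ;; f \<boxtimes> u \<boxtimes> u) ;; (m' \<boxtimes> \<i>\<d> Y' ;; M)"
    unfolding 1 by (metis comp_assoc[OF ds fuu mY'] comp_assoc[OF comp_hom[OF ds fuu] mY' M] comp_assoc[OF dY s fuu])
  also have "\<dots> = d \<boxtimes> \<i>\<d> Y ;; f \<boxtimes> u \<boxtimes> u ;; (\<i>\<d> Q' \<boxtimes> \<gamma> Y' Y' ;; (m' \<boxtimes> \<i>\<d> Y' ;; M))"
    unfolding swap_last_two[OF f u, symmetric] by (metis comp_assoc[OF dY fuu s'] comp_assoc[OF comp_hom[OF dY fuu] s' comp_hom[OF mY' M]])
  also have "\<dots> = d \<boxtimes> \<i>\<d> Y ;; f \<boxtimes> u \<boxtimes> u ;; m' \<boxtimes> \<i>\<d> Y' ;; M"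
    unfolding comm by (metis comp_assoc[OF comp_hom[OF dY fuu] mY' M])
  finally show ?thesis unfolding 2 .
qed

text \<open>Intended reading: \<open>D\<close>, \<open>d\<close>, \<open>G\<close>, \<open>k\<close>
  are the comultiplications with indices \<open>(n+p, 1)\<close>, \<open>(n, p)\<close>,
  \<open>(n, p+1)\<close>, \<open>(p, 1)\<close>. Coassociativity trades the unknown compatibility
  with \<open>G\<close> for the known ones with \<open>D\<close>, \<open>d\<close> and
  \<open>k\<close>. The price is the trailing factor \<open>k'\<close>, to be cancelled
  afterwards.\<close>

lemma comul_extend:
  assumes F: "F \<in> Hom C Z Z'" and D: "D \<in> Hom C Z (N \<boxdot> Y)" and D': "D' \<in> Hom C Z' (N' \<boxdot> Y')"
    and g: "g \<in> Hom C N N'" and u: "u \<in> Hom C Y Y'" and FD: "F ;; D' = D ;; g \<boxtimes> u"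
    and d: "d \<in> Hom C N (P \<boxdot> Q)" and d': "d' \<in> Hom C N' (P' \<boxdot> Q')"
    and f: "f \<in> Hom C P P'" and h: "h \<in> Hom C Q Q'" and gd: "g ;; d' = d ;; f \<boxtimes> h"
    and G: "G \<in> Hom C Z (P \<boxdot> R)" and G': "G' \<in> Hom C Z' (P' \<boxdot> R')"
    and k: "k \<in> Hom C R (Q \<boxdot> Y)" and k': "k' \<in> Hom C R' (Q' \<boxdot> Y')"
    and l: "l \<in> Hom C R R'" and lk: "l ;; k' = k ;; h \<boxtimes> u"
    and coassoc: "D ;; d \<boxtimes> \<i>\<d> Y = G ;; \<i>\<d> P \<boxtimes> k" "D' ;; d' \<boxtimes> \<i>\<d> Y' = G' ;; \<i>\<d> P' \<boxtimes> k'"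
  shows "F ;; G' ;; \<i>\<d> P' \<boxtimes> k' = G ;; f \<boxtimes> l ;; \<i>\<d> P' \<boxtimes> k'"
proof -
  have [simp]: "Y \<in> Obj C" "Y' \<in> Obj C" "P \<in> Obj C" "P' \<in> Obj C" "Q \<in> Obj C" "Q' \<in> Obj C"
    using hom_obj f h u by auto
  have dY: "d \<boxtimes> \<i>\<d> Y \<in> Hom C (N \<boxdot> Y) (P \<boxdot> Q \<boxdot> Y)"
    and dY': "d' \<boxtimes> \<i>\<d> Y' \<in> Hom C (N' \<boxdot> Y') (P' \<boxdot> Q' \<boxdot> Y')"
    using tensor_hom[OF d id_hom] tensor_hom[OF d' id_hom] by (simp_all add: tensor_obj_assoc)
  have Pk: "\<i>\<d> P \<boxtimes> k \<in> Hom C (P \<boxdot> R) (P \<boxdot> Q \<boxdot> Y)"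
    and Pk': "\<i>\<d> P' \<boxtimes> k' \<in> Hom C (P' \<boxdot> R') (P' \<boxdot> Q' \<boxdot> Y')"
    by (simp_all add: tensor_hom id_hom k k')
  note fh = tensor_hom[OF f h] and hu = tensor_hom[OF h u]
  have "F ;; G' ;; \<i>\<d> P' \<boxtimes> k' = D ;; g \<boxtimes> u ;; d' \<boxtimes> \<i>\<d> Y'"
    by (metis comp_assoc[OF F G' Pk'] comp_assoc[OF F D' dY'] coassoc(2) FD)
  also have "\<dots> = D ;; d \<boxtimes> \<i>\<d> Y ;; f \<boxtimes> h \<boxtimes> u"
    using comp_assoc[OF D tensor_hom[OF g u] dY'] comp_assoc[OF D dY tensor_hom[OF f hu]]
      tensor_comp_left[OF g d' u] comp_tensor_left[OF d fh u] tensor_assoc[OF f h u] gd by simp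
  also have "\<dots> = G ;; f \<boxtimes> (k ;; h \<boxtimes> u)"
    using comp_assoc[OF G Pk tensor_hom[OF f hu]] comp_tensor_right[OF f k hu] coassoc(1) by simp
  also have "\<dots> = G ;; f \<boxtimes> l ;; \<i>\<d> P' \<boxtimes> k'"
    using comp_assoc[OF G tensor_hom[OF f l] Pk'] tensor_comp_right[OF f l k'] lk by simp
  finally show ?thesis .
qed

text \<open>Dual of \<open>comul_extend\<close>, by associativity; the factor to be cancelled,
  \<open>k\<close>, now stands in front.\<close>

lemma mul_extend:
  assumes F: "F \<in> Hom C Z Z'" and M: "M \<in> Hom C (N \<boxdot> Y) Z" and M': "M' \<in> Hom C (N' \<boxdot> Y') Z'"
    and g: "g \<in> Hom C N N'" and u: "u \<in> Hom C Y Y'" and MF: "M ;; F = g \<boxtimes> u ;; M'"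
    and m: "m \<in> Hom C (P \<boxdot> Q) N" and m': "m' \<in> Hom C (P' \<boxdot> Q') N'"
    and f: "f \<in> Hom C P P'" and h: "h \<in> Hom C Q Q'" and mg: "m ;; g = f \<boxtimes> h ;; m'"
    and K: "K \<in> Hom C (P \<boxdot> R) Z" and K': "K' \<in> Hom C (P' \<boxdot> R') Z'"
    and k: "k \<in> Hom C (Q \<boxdot> Y) R" and k': "k' \<in> Hom C (Q' \<boxdot> Y') R'"
    and l: "l \<in> Hom C R R'" and kl: "k ;; l = h \<boxtimes> u ;; k'"
    and assoc: "m \<boxtimes> \<i>\<d> Y ;; M = \<i>\<d> P \<boxtimes> k ;; K" "m' \<boxtimes> \<i>\<d> Y' ;; M' = \<i>\<d> P' \<boxtimes> k' ;; K'"
  shows "\<i>\<d> P \<boxtimes> k ;; (K ;; F) = \<i>\<d> P \<boxtimes> k ;; (f \<boxtimes> l ;; K')"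
proof -
  have [simp]: "Y \<in> Obj C" "Y' \<in> Obj C" "P \<in> Obj C" "P' \<in> Obj C" "Q \<in> Obj C" "Q' \<in> Obj C"
    using hom_obj f h u by auto
  have mY: "m \<boxtimes> \<i>\<d> Y \<in> Hom C (P \<boxdot> Q \<boxdot> Y) (N \<boxdot> Y)"
    and mY': "m' \<boxtimes> \<i>\<d> Y' \<in> Hom C (P' \<boxdot> Q' \<boxdot> Y') (N' \<boxdot> Y')"
    using tensor_hom[OF m id_hom] tensor_hom[OF m' id_hom] by (simp_all add: tensor_obj_assoc)
  have Pk: "\<i>\<d> P \<boxtimes> k \<in> Hom C (P \<boxdot> Q \<boxdot> Y) (P \<boxdot> R)"
    and Pk': "\<i>\<d> P' \<boxtimes> k' \<in> Hom C (P' \<boxdot> Q' \<boxdot> Y') (P' \<boxdot> R')"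
    by (simp_all add: tensor_hom id_hom k k')
  note fh = tensor_hom[OF f h] and hu = tensor_hom[OF h u]
  have "\<i>\<d> P \<boxtimes> k ;; (K ;; F) = m \<boxtimes> \<i>\<d> Y ;; (g \<boxtimes> u ;; M')"
    by (metis comp_assoc[OF Pk K F] comp_assoc[OF mY M F] assoc(1) MF)
  also have "\<dots> = f \<boxtimes> h \<boxtimes> u ;; (m' \<boxtimes> \<i>\<d> Y' ;; M')"
    by (metis comp_assoc[OF mY tensor_hom[OF g u] M'] comp_assoc[OF tensor_hom[OF f hu] mY' M']
      comp_tensor_left[OF m g u] tensor_comp_left[OF fh m' u] tensor_assoc[OF f h u] mg)
  also have "\<dots> = f \<boxtimes> (h \<boxtimes> u ;; k') ;; K'"
    using comp_assoc[OF tensor_hom[OF f hu] Pk' K'] tensor_comp_right[OF f hu k'] assoc(2) by simp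
  also have "\<dots> = \<i>\<d> P \<boxtimes> k ;; (f \<boxtimes> l ;; K')"
    using comp_assoc[OF Pk tensor_hom[OF f l] K'] comp_tensor_right[OF f k l] kl by simp
  finally show ?thesis .
qed

end

section \<open>Consequences of the axioms for a single binomial bimonoid\<close>

context binomial_bimonoid
begin

text \<open>Typings with \<open>Suc\<close> outermost, the form in which indices appear in the
  inductions.\<close>

lemma delta_1_hom: "\<Delta> n 1 \<in> Hom C (A (Suc n)) (A n \<boxdot> A 1)"
  and nabla_1_hom: "\<nabla> n 1 \<in> Hom C (A n \<boxdot> A 1) (A (Suc n))"
  and delta_Suc_hom: "\<Delta> n (Suc p) \<in> Hom C (A (Suc (n + p))) (A n \<boxdot> A (Suc p))"
  and nabla_Suc_hom: "\<nabla> n (Suc p) \<in> Hom C (A n \<boxdot> A (Suc p)) (A (Suc (n + p)))"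
  using delta_hom[of n 1] nabla_hom[of n 1] delta_hom[of n "Suc p"] nabla_hom[of n "Suc p"] by simp_all

lemma delta_1_nabla_1: "\<Delta> n 1 ;; \<nabla> n 1 = of_nat (Suc n) \<cdot> \<i>\<d> (A (Suc n))"
  using delta_nabla[of n 1] by simp

text \<open>Composing further with \<open>\<i>\<d> (A n) \<boxtimes> \<nabla> p 1\<close> turns
  either side into \<open>p+1\<close> times the original map, a scalar that cancels.\<close>

lemma delta_1_cancel:
  assumes f: "f \<in> Hom C X (A n \<boxdot> A (Suc p))" and g: "g \<in> Hom C X (A n \<boxdot> A (Suc p))"
    and eq: "f ;; \<i>\<d> (A n) \<boxtimes> \<Delta> p 1 = g ;; \<i>\<d> (A n) \<boxtimes> \<Delta> p 1"
  shows "f = g"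
proof -
  note I = id_hom[OF obj[of n]] and J = id_hom[OF obj[of "Suc p"]]
  note D = tensor_hom[OF I delta_1_hom[of p]] and M = tensor_hom[OF I nabla_1_hom[of p]]
  have "h ;; \<i>\<d> (A n) \<boxtimes> \<Delta> p 1 ;; \<i>\<d> (A n) \<boxtimes> \<nabla> p 1 = of_nat (Suc p) \<cdot> h"
    if h: "h \<in> Hom C X (A n \<boxdot> A (Suc p))" for h
    using comp_assoc[OF h D M] tensor_comp_right[OF I delta_1_hom nabla_1_hom] delta_1_nabla_1[of p]
      tensor_scale_right[OF _ I J, of "of_nat (Suc p)"]
      comp_scale_right[OF _ h tensor_hom[OF I J], of "of_nat (Suc p)"]
      id_right[OF h] by (simp add: tensor_id obj del: of_nat_Suc One_nat_def)
  then have "of_nat (Suc p) \<cdot> f = of_nat (Suc p) \<cdot> g" using eq f g by metis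
  then show ?thesis by (rule scale_inverse_eq[OF f g, rotated]) simp
qed

text \<open>Dual argument: compose with \<open>\<i>\<d> (A n) \<boxtimes> \<Delta> p 1\<close> in
  front.\<close>

lemma nabla_1_cancel:
  assumes f: "f \<in> Hom C (A n \<boxdot> A (Suc p)) X" and g: "g \<in> Hom C (A n \<boxdot> A (Suc p)) X"
    and eq: "\<i>\<d> (A n) \<boxtimes> \<nabla> p 1 ;; f = \<i>\<d> (A n) \<boxtimes> \<nabla> p 1 ;; g"
  shows "f = g"
proof -
  note I = id_hom[OF obj[of n]] and J = id_hom[OF obj[of "Suc p"]]
  note D = tensor_hom[OF I delta_1_hom[of p]] and M = tensor_hom[OF I nabla_1_hom[of p]]
  have "\<i>\<d> (A n) \<boxtimes> \<Delta> p 1 ;; (\<i>\<d> (A n) \<boxtimes> \<nabla> p 1 ;; h) = of_nat (Suc p) \<cdot> h"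
    if h: "h \<in> Hom C (A n \<boxdot> A (Suc p)) X" for h
    using comp_assoc[OF D M h] tensor_comp_right[OF I delta_1_hom nabla_1_hom] delta_1_nabla_1[of p]
      tensor_scale_right[OF _ I J, of "of_nat (Suc p)"]
      comp_scale_left[OF _ tensor_hom[OF I J] h, of "of_nat (Suc p)"]
      id_left[OF h] by (simp add: tensor_id obj del: of_nat_Suc One_nat_def)
  then have "of_nat (Suc p) \<cdot> f = of_nat (Suc p) \<cdot> g" using eq f g by metis
  then show ?thesis by (rule scale_inverse_eq[OF f g, rotated]) simp
qed

text \<open>Since \<open>\<epsilon>\<close> and \<open>\<eta>\<close> are mutually inverse, the
  counit law can be solved for \<open>\<Delta> 0 n\<close>. The unit law gives the dual
  \<open>nabla_0_left\<close> in the same way, and (co)commutativity moves the degree 0 factor to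
  the right.\<close>

lemma delta_0_left: "\<Delta> 0 n = \<eta> \<boxtimes> \<i>\<d> (A n)"
proof -
  have D: "\<Delta> 0 n \<in> Hom C (A n) (A 0 \<boxdot> A n)" using delta_hom[of 0 n] by simp
  note E = tensor_hom[OF eps_hom id_hom[OF obj[of n]]] tensor_hom[OF eta_hom id_hom[OF obj[of n]]]
  have "\<epsilon> \<boxtimes> \<i>\<d> (A n) ;; \<eta> \<boxtimes> \<i>\<d> (A n) = \<i>\<d> (A 0 \<boxdot> A n)"
    using tensor_comp_left[OF eps_hom eta_hom id_hom[OF obj[of n]]] by (simp add: eps_eta tensor_id obj)
  then show ?thesis
    using comp_assoc[OF D E] id_right[OF D] id_left[OF E(2)]
    by (simp add: delta_counit tensor_obj_unit_left obj)
qed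

lemma nabla_0_left: "\<nabla> 0 n = \<epsilon> \<boxtimes> \<i>\<d> (A n)"
proof -
  have D: "\<nabla> 0 n \<in> Hom C (A 0 \<boxdot> A n) (A n)" using nabla_hom[of 0 n] by simp
  note E = tensor_hom[OF eps_hom id_hom[OF obj[of n]]] tensor_hom[OF eta_hom id_hom[OF obj[of n]]]
  have "\<epsilon> \<boxtimes> \<i>\<d> (A n) ;; \<eta> \<boxtimes> \<i>\<d> (A n) = \<i>\<d> (A 0 \<boxdot> A n)"
    using tensor_comp_left[OF eps_hom eta_hom id_hom[OF obj[of n]]] by (simp add: eps_eta tensor_id obj)
  then show ?thesis
    using comp_assoc[OF E D] id_left[OF D] id_right[OF E(1)]
    by (simp add: nabla_unit tensor_obj_unit_left obj)
qed

lemma delta_0_right: "\<Delta> n 0 = \<i>\<d> (A n) \<boxtimes> \<eta>"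
  using delta_cocomm[of 0 n] sym_natural[OF eta_hom id_hom[OF obj[of n]]]
    id_left[OF tensor_hom[OF id_hom[OF obj[of n]] eta_hom]]
  by (simp add: delta_0_left sym_unit_left obj tensor_obj_unit_right)

lemma nabla_0_right: "\<nabla> n 0 = \<i>\<d> (A n) \<boxtimes> \<epsilon>"
  using nabla_comm[of n 0] sym_natural[OF id_hom[OF obj[of n]] eps_hom]
    id_right[OF tensor_hom[OF id_hom[OF obj[of n]] eps_hom]]
  by (simp add: nabla_0_left sym_unit obj tensor_obj_unit_right)

text \<open>By coassociativity the double splitting factors through \<open>\<Delta> 1 1\<close>,
  whose cocommutativity absorbs the swap. This supplies the hypothesis \<open>cocomm\<close> of
  \<open>comul_step\<close>; the next lemma supplies \<open>comm\<close> of
  \<open>mul_step\<close>.\<close>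

lemma delta_swap_last_two:
  "\<Delta> (Suc n) 1 ;; \<Delta> n 1 \<boxtimes> \<i>\<d> (A 1) ;; \<i>\<d> (A n) \<boxtimes> \<gamma> (A 1) (A 1)
    = \<Delta> (Suc n) 1 ;; \<Delta> n 1 \<boxtimes> \<i>\<d> (A 1)"
proof -
  have D: "\<Delta> n 2 \<in> Hom C (A (n + 2)) (A n \<boxdot> A 2)" and d: "\<Delta> 1 1 \<in> Hom C (A 2) (A 1 \<boxdot> A 1)"
    using delta_hom[of n 2] delta_hom[of 1 1] by (simp_all add: numeral_2_eq_2)
  have co: "\<Delta> (Suc n) 1 ;; \<Delta> n 1 \<boxtimes> \<i>\<d> (A 1) = \<Delta> n 2 ;; \<i>\<d> (A n) \<boxtimes> \<Delta> 1 1"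
    using delta_coassoc[of n 1 1] by (simp add: numeral_2_eq_2)
  note I = id_hom[OF obj[of n]] and sym = sym_hom[OF obj[of 1] obj[of 1]]
  show ?thesis unfolding co
    using comp_assoc[OF D tensor_hom[OF I d] tensor_hom[OF I sym]] tensor_comp_right[OF I d sym]
      delta_cocomm[of 1 1]
    by simp
qed

lemma nabla_swap_last_two:
  "\<i>\<d> (A n) \<boxtimes> \<gamma> (A 1) (A 1) ;; (\<nabla> n 1 \<boxtimes> \<i>\<d> (A 1) ;; \<nabla> (Suc n) 1)
    = \<nabla> n 1 \<boxtimes> \<i>\<d> (A 1) ;; \<nabla> (Suc n) 1"
proof -
  have D: "\<nabla> n 2 \<in> Hom C (A n \<boxdot> A 2) (A (n + 2))" and d: "\<nabla> 1 1 \<in> Hom C (A 1 \<boxdot> A 1) (A 2)"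
    using nabla_hom[of n 2] nabla_hom[of 1 1] by (simp_all add: numeral_2_eq_2)
  have co: "\<nabla> n 1 \<boxtimes> \<i>\<d> (A 1) ;; \<nabla> (Suc n) 1 = \<i>\<d> (A n) \<boxtimes> \<nabla> 1 1 ;; \<nabla> n 2"
    using nabla_assoc[of n 1 1] by (simp add: numeral_2_eq_2)
  note I = id_hom[OF obj[of n]] and sym = sym_hom[OF obj[of 1] obj[of 1]]
  show ?thesis unfolding co
    using comp_assoc[OF tensor_hom[OF I sym] tensor_hom[OF I d] D] comp_tensor_right[OF I sym d]
      nabla_comm[of 1 1]
    by simp
qed

lemma swap_summand_hom:
  "\<Delta> n 1 \<boxtimes> \<i>\<d> (A 1) ;; \<i>\<d> (A n) \<boxtimes> \<gamma> (A 1) (A 1) ;; \<nabla> n 1 \<boxtimes> \<i>\<d> (A 1)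
    \<in> Hom C (A (Suc n) \<boxdot> A 1) (A (Suc n) \<boxdot> A 1)"
proof -
  note I = id_hom[OF obj]
  have "\<i>\<d> (A n) \<boxtimes> \<gamma> (A 1) (A 1) \<in> Hom C ((A n \<boxdot> A 1) \<boxdot> A 1) ((A n \<boxdot> A 1) \<boxdot> A 1)"
    using tensor_hom[OF I[of n] sym_hom[OF obj[of 1] obj[of 1]]] by (simp add: tensor_obj_assoc obj)
  then show ?thesis
    by (intro comp_hom[OF comp_hom[OF tensor_hom[OF delta_1_hom I]] tensor_hom[OF nabla_1_hom I]])
qed

text \<open>The bialgebra law specialised so that its sum has just two terms. This is the source of
  the count \<open>1 + (n+1)\<close> in the later inductions.\<close>

lemma nabla_delta_Suc_1:
  "\<nabla> (Suc n) 1 ;; \<Delta> (Suc n) 1 = \<i>\<d> (A (Suc n) \<boxdot> A 1) \<boxplus>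
    \<Delta> n 1 \<boxtimes> \<i>\<d> (A 1) ;; \<i>\<d> (A n) \<boxtimes> \<gamma> (A 1) (A 1) ;; \<nabla> n 1 \<boxtimes> \<i>\<d> (A 1)"
proof -
  let ?T = "\<lambda>(a, b, c, d).
    \<Delta> a b \<boxtimes> \<Delta> c d ;; \<i>\<d> (A a) \<boxtimes> \<gamma> (A b) (A c) \<boxtimes> \<i>\<d> (A d) ;; \<nabla> a c \<boxtimes> \<nabla> b d"
  let ?X = "A (Suc n)" and ?Y = "A 1" and ?Q = "A n"
  let ?I = "\<i>\<d> ?X" and ?J = "\<i>\<d> ?Y"
  note [simp] = obj unit_obj tensor_obj tensor_obj_assoc tensor_obj_unit_left tensor_obj_unit_right
  have X: "?I \<in> Hom C ?X ?X" and Y: "?J \<in> Hom C ?Y ?Y" and Q: "\<i>\<d> ?Q \<in> Hom C ?Q ?Q"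
    by (simp_all add: id_hom)
  \<comment> \<open>The constraints force \<open>b = c\<close> and \<open>b + d = 1\<close>, so
    \<open>b\<close> is 0 or 1 and determines the quadruple.\<close>
  have S: "{(a, b, c, d). a + b = Suc n \<and> c + d = 1 \<and> a + c = Suc n \<and> b + d = 1}
      = {(Suc n, 0, 0, 1), (n, 1, 1, 0)}"
    by auto
  \<comment> \<open>All exchanged factors have degree 0: the inner copies of \<open>A 0\<close> are
    created by \<open>\<eta> \<boxtimes> \<eta>\<close>, swapped, and removed by
    \<open>\<epsilon> \<boxtimes> \<epsilon>\<close>, which amounts to the identity of the unit
    object.\<close>
  have T1: "?T (Suc n, 0, 0, 1) = \<i>\<d> (?X \<boxdot> ?Y)"
  proof -
    let ?s = "\<gamma> (A 0) (A 0)"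
    have ee: "\<eta> \<boxtimes> \<eta> \<in> Hom C \<I> (A 0 \<boxdot> A 0)" and dd: "\<epsilon> \<boxtimes> \<epsilon> \<in> Hom C (A 0 \<boxdot> A 0) \<I>"
      and s: "?s \<in> Hom C (A 0 \<boxdot> A 0) (A 0 \<boxdot> A 0)"
      using tensor_hom[OF eta_hom eta_hom] tensor_hom[OF eps_hom eps_hom] by (simp_all add: sym_hom)
    have "\<eta> \<boxtimes> \<eta> ;; ?s = \<eta> \<boxtimes> \<eta>"
      using sym_natural[OF eta_hom eta_hom] id_left[OF ee] by (simp add: sym_unit)
    moreover have "\<eta> \<boxtimes> \<eta> ;; \<epsilon> \<boxtimes> \<epsilon> = \<i>\<d> \<I>"
      using tensor_comp[OF eta_hom eps_hom eta_hom eps_hom] by (simp add: eta_eps tensor_id)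
    ultimately have mid: "\<eta> \<boxtimes> \<eta> ;; ?s ;; \<epsilon> \<boxtimes> \<epsilon> = \<i>\<d> \<I>" by simp
    have eJ: "(\<eta> \<boxtimes> \<eta>) \<boxtimes> ?J ;; ?s \<boxtimes> ?J ;; (\<epsilon> \<boxtimes> \<epsilon>) \<boxtimes> ?J = ?J"
      using tensor_comp_left[OF ee s Y] tensor_comp_left[OF comp_hom[OF ee s] dd Y]
      by (simp add: mid tensor_unit_left[OF Y] del: One_nat_def)
    have "?I \<boxtimes> (\<eta> \<boxtimes> \<eta>) \<boxtimes> ?J ;; ?I \<boxtimes> ?s \<boxtimes> ?J ;; ?I \<boxtimes> (\<epsilon> \<boxtimes> \<epsilon>) \<boxtimes> ?J = ?I \<boxtimes> ?J"
      using tensor_comp_right[OF X tensor_hom[OF ee Y] tensor_hom[OF s Y]]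
        tensor_comp_right[OF X comp_hom[OF tensor_hom[OF ee Y] tensor_hom[OF s Y]] tensor_hom[OF dd Y]]
      by (simp add: eJ del: One_nat_def)
    moreover have "(?I \<boxtimes> e) \<boxtimes> (e \<boxtimes> ?J) = ?I \<boxtimes> (e \<boxtimes> e) \<boxtimes> ?J" if "e \<in> Hom C V W" for e V W
      using tensor_assoc[OF X that tensor_hom[OF that Y]] tensor_assoc[OF that that Y] by simp
    note this[OF eta_hom] this[OF eps_hom]
    ultimately show ?thesis
      by (simp add: delta_0_right delta_0_left nabla_0_right nabla_0_left tensor_id del: One_nat_def)
  qed
  have D: "\<Delta> n 1 \<in> Hom C ?X (?Q \<boxdot> ?Y)" and N: "\<nabla> n 1 \<in> Hom C (?Q \<boxdot> ?Y) ?X"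
    using delta_hom[of n 1] nabla_hom[of n 1] by simp_all
  let ?d = "\<Delta> n 1 \<boxtimes> ?J" and ?s = "\<i>\<d> ?Q \<boxtimes> \<gamma> ?Y ?Y" and ?m = "\<nabla> n 1 \<boxtimes> ?J"
  have d: "?d \<in> Hom C (?X \<boxdot> ?Y) (?Q \<boxdot> ?Y \<boxdot> ?Y)" and m: "?m \<in> Hom C (?Q \<boxdot> ?Y \<boxdot> ?Y) (?X \<boxdot> ?Y)"
    and g: "\<gamma> ?Y ?Y \<in> Hom C (?Y \<boxdot> ?Y) (?Y \<boxdot> ?Y)" and s: "?s \<in> Hom C (?Q \<boxdot> ?Y \<boxdot> ?Y) (?Q \<boxdot> ?Y \<boxdot> ?Y)"
    and id0: "\<i>\<d> (A 0) \<in> Hom C (A 0) (A 0)"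
    using tensor_hom[OF D Y] tensor_hom[OF N Y] by (simp_all add: sym_hom tensor_hom id_hom)
  \<comment> \<open>Only the last factor has degree 0; it is created by \<open>\<eta>\<close> and
    removed by \<open>\<epsilon>\<close>, leaving the swap of the two degree 1 factors.\<close>
  have T2: "?T (n, 1, 1, 0) = ?d ;; ?s ;; ?m"
    using tensor_comp[OF d s eta_hom id0] tensor_comp[OF comp_hom[OF d s] m eta_hom eps_hom]
      tensor_assoc[OF D Y eta_hom] tensor_assoc[OF Q g id0] tensor_assoc[OF N Y eps_hom]
      tensor_unit_right[OF comp_hom[OF comp_hom[OF d s] m]] id_right[OF eta_hom]
    by (simp add: delta_0_right nabla_0_right eta_eps del: One_nat_def)
  have h: "?d ;; ?s ;; ?m \<in> Hom C (?X \<boxdot> ?Y) (?X \<boxdot> ?Y)" "\<i>\<d> (?X \<boxdot> ?Y) \<in> Hom C (?X \<boxdot> ?Y) (?X \<boxdot> ?Y)"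
    by (rule swap_summand_hom) (simp add: id_hom)
  interpret H: comm_monoid "hom_monoid C (?X \<boxdot> ?Y) (?X \<boxdot> ?Y)"
    by (simp add: hom_comm_monoid)
  let ?H = "hom_monoid C (?X \<boxdot> ?Y) (?X \<boxdot> ?Y)"
  \<comment> \<open>Membership in the carrier is what allows \<open>finprod\<close> to be expanded
    over the two quadruples.\<close>
  have "?T (Suc n, 0, 0, 1) \<in> carrier ?H" "?T (n, 1, 1, 0) \<in> carrier ?H"
    unfolding T1 T2 using h by (simp_all add: hom_monoid_def)
  then have "finprod ?H ?T {(Suc n, 0, 0, 1), (n, 1, 1, 0)}
      = ?T (Suc n, 0, 0, 1) \<otimes>\<^bsub>?H\<^esub> ?T (n, 1, 1, 0)"
    by (simp del: One_nat_def)
  also have "\<dots> = \<i>\<d> (?X \<boxdot> ?Y) \<boxplus> (?d ;; ?s ;; ?m)"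
    unfolding T1 T2 by (simp add: hom_monoid_def)
  finally have "finprod ?H ?T {(Suc n, 0, 0, 1), (n, 1, 1, 0)}
      = \<i>\<d> (?X \<boxdot> ?Y) \<boxplus> (?d ;; ?s ;; ?m)" .
  then show ?thesis
    using nabla_delta[of "Suc n" 1 "Suc n" 1] unfolding S by simp
qed

end

section \<open>Extending a degree 1 map to all degrees\<close>

locale binomial_extension = nonneg_rat_linear_smc C +
  A: binomial_bimonoid C A nablaA \<Delta>A \<eta>A \<epsilon>A + B: binomial_bimonoid C B nablaB \<Delta>B \<eta>B \<epsilon>B
  for C :: "('o, 'm, 'z) linear_category_scheme" (structure)
    and A nablaA \<Delta>A \<eta>A \<epsilon>A B nablaB \<Delta>B \<eta>B \<epsilon>B +
  fixes u :: 'm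
  assumes u_hom: "u \<in> Hom C (A 1) (B 1)"
begin

text \<open>Both clauses are forced on a bimonoid morphism with degree 1 component \<open>u\<close>,
  by \<open>\<epsilon> ;; \<eta>\<close> being an identity and by \<open>delta_nabla\<close>.
  Unfolded, \<open>n!\<close> times \<open>extension n\<close> is the iterated comultiplication,
  then the \<open>n\<close>-fold tensor power of \<open>u\<close>, then the iterated
  multiplication.\<close>

primrec extension :: "nat \<Rightarrow> 'm" where
  "extension 0 = \<epsilon>A ;; \<eta>B"
| "extension (Suc n) = inverse (of_nat (Suc n)) \<cdot> (\<Delta>A n 1 ;; extension n \<boxtimes> u ;; nablaB n 1)"

lemma extension_hom: "extension n \<in> Hom C (A n) (B n)"
proof (induction n)
  case 0
  show ?case using comp_hom[OF A.eps_hom B.eta_hom] by simp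
next
  case (Suc n)
  show ?case
    using comp_hom[OF comp_hom[OF A.delta_1_hom tensor_hom[OF Suc u_hom]] B.nabla_1_hom]
    by (auto intro!: scale_hom)
qed

lemma scale_extension_Suc:
  "of_nat (Suc n) \<cdot> extension (Suc n) = \<Delta>A n 1 ;; extension n \<boxtimes> u ;; nablaB n 1"
proof -
  have h: "\<Delta>A n 1 ;; extension n \<boxtimes> u ;; nablaB n 1 \<in> Hom C (A (Suc n)) (B (Suc n))"
    by (rule comp_hom[OF comp_hom[OF A.delta_1_hom tensor_hom[OF extension_hom u_hom]] B.nabla_1_hom])
  show ?thesis
    using scale_scale[OF _ _ h, of "of_nat (Suc n)" "inverse (of_nat (Suc n))"] scale_one[OF h]
    by (simp del: of_nat_Suc)
qed

lemma eta_extension_0: "\<eta>A ;; extension 0 = \<eta>B"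
  using comp_assoc[OF A.eta_hom A.eps_hom B.eta_hom] id_left[OF B.eta_hom] by (simp add: A.eta_eps)

lemma extension_0_eps: "extension 0 ;; \<epsilon>B = \<epsilon>A"
  using comp_assoc[OF A.eps_hom B.eta_hom B.eps_hom] id_right[OF A.eps_hom] by (simp add: B.eta_eps)

text \<open>Both sides equal \<open>\<eta>B \<boxtimes> f\<close>, so any \<open>f\<close> will do;
  the base cases below take \<open>f\<close> to be \<open>u\<close>. The next three lemmas are the
  mirrored and dual versions.\<close>

lemma delta_0_extension:
  assumes "f \<in> Hom C (A n) (B n)"
  shows "\<Delta>A 0 n ;; extension 0 \<boxtimes> f = f ;; \<Delta>B 0 n"
  using comp_tensor_left[OF A.eta_hom extension_hom assms]
    tensor_comp[OF id_hom[OF unit_obj] B.eta_hom assms id_hom[OF B.obj]]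
    id_left[OF B.eta_hom] id_right[OF assms] tensor_unit_left[OF assms]
  by (simp add: A.delta_0_left B.delta_0_left eta_extension_0 del: extension.simps)

lemma extension_nabla_0:
  assumes "f \<in> Hom C (A n) (B n)"
  shows "extension 0 \<boxtimes> f ;; nablaB 0 n = nablaA 0 n ;; f"
  using tensor_comp_left[OF extension_hom B.eps_hom assms]
    tensor_comp[OF A.eps_hom id_hom[OF unit_obj] id_hom[OF A.obj] assms]
    id_right[OF A.eps_hom] id_left[OF assms] tensor_unit_left[OF assms]
  by (simp add: A.nabla_0_left B.nabla_0_left extension_0_eps del: extension.simps)

lemma delta_extension_0:
  assumes "f \<in> Hom C (A n) (B n)"
  shows "\<Delta>A n 0 ;; f \<boxtimes> extension 0 = f ;; \<Delta>B n 0"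
  using comp_tensor_right[OF assms A.eta_hom extension_hom]
    tensor_comp[OF assms id_hom[OF B.obj] id_hom[OF unit_obj] B.eta_hom]
    id_left[OF B.eta_hom] id_right[OF assms] tensor_unit_right[OF assms]
  by (simp add: A.delta_0_right B.delta_0_right eta_extension_0 del: extension.simps)

lemma extension_0_nabla:
  assumes "f \<in> Hom C (A n) (B n)"
  shows "f \<boxtimes> extension 0 ;; nablaB n 0 = nablaA n 0 ;; f"
  using tensor_comp_right[OF assms extension_hom B.eps_hom]
    tensor_comp[OF id_hom[OF A.obj] assms A.eps_hom id_hom[OF unit_obj]]
    id_right[OF A.eps_hom] id_left[OF assms] tensor_unit_right[OF assms]
  by (simp add: A.nabla_0_right B.nabla_0_right extension_0_eps del: extension.simps)

text \<open>The previous lemmas move \<open>u\<close> in front of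
  \<open>\<Delta>B 0 1 ;; nablaB 0 1\<close>, and this is the identity because its binomial
  coefficient is 1.\<close>

lemma extension_1: "extension 1 = u"
proof -
  have D: "\<Delta>B 0 1 \<in> Hom C (B 1) (B 0 \<boxdot> B 1)" and M: "nablaB 0 1 \<in> Hom C (B 0 \<boxdot> B 1) (B 1)"
    using B.delta_hom[of 0 1] B.nabla_hom[of 0 1] by simp_all
  have "\<Delta>A 0 1 ;; extension 0 \<boxtimes> u ;; nablaB 0 1 = u"
    using delta_0_extension[OF u_hom] comp_assoc[OF u_hom D M] B.delta_nabla[of 0 1] id_right[OF u_hom]
    by (simp add: scale_one[OF id_hom[OF B.obj]] del: extension.simps One_nat_def)
  then show ?thesis
    using scale_extension_Suc[of 0] scale_one[OF extension_hom[of 1]] by (simp del: extension.simps)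
qed

section \<open>Compatibility of the extension with comultiplication and multiplication\<close>

lemma extension_delta_1: "extension (Suc n) ;; \<Delta>B n 1 = \<Delta>A n 1 ;; extension n \<boxtimes> u"
proof (induction n)
  case 0
  show ?case
    using extension_1 delta_0_extension[OF u_hom] by (simp del: extension.simps)
next
  case (Suc n)
  let ?F = "extension (Suc n)" and ?s = "of_nat (Suc n)"
  let ?S = "\<Delta>B n 1 \<boxtimes> \<i>\<d> (B 1) ;; \<i>\<d> (B n) \<boxtimes> \<gamma> (B 1) (B 1) ;; nablaB n 1 \<boxtimes> \<i>\<d> (B 1)"
  note D = A.delta_1_hom[of "Suc n"] and Fu = tensor_hom[OF extension_hom[of "Suc n"] u_hom]
    and M = B.nabla_1_hom[of "Suc n"] and D' = B.delta_1_hom[of "Suc n"]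
  let ?L = "\<Delta>A (Suc n) 1 ;; ?F \<boxtimes> u"
  have L: "?L \<in> Hom C (A (Suc (Suc n))) (B (Suc n) \<boxdot> B 1)" by (rule comp_hom[OF D Fu])
  have S: "?S \<in> Hom C (B (Suc n) \<boxdot> B 1) (B (Suc n) \<boxdot> B 1)"
    by (rule B.swap_summand_hom)
  \<comment> \<open>The chase produces the unscaled recursion for \<open>?F\<close>, that is
    \<open>n+1\<close> times \<open>?F\<close>; the scalar then moves out of the tensor and the
    composite.\<close>
  have "?L ;; ?S = \<Delta>A (Suc n) 1 ;; (?s \<cdot> ?F) \<boxtimes> u"
    unfolding scale_extension_Suc
    by (rule comul_step[OF D A.delta_1_hom A.delta_swap_last_two extension_hom extension_hom u_hom
          B.delta_1_hom B.nabla_1_hom Suc])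
  also have "\<dots> = ?s \<cdot> ?L"
    using tensor_scale_left[OF _ extension_hom[of "Suc n"] u_hom, of ?s] comp_scale_right[OF _ D Fu, of ?s]
    by (simp del: of_nat_Suc One_nat_def extension.simps)
  finally have S_eq: "?L ;; ?S = ?s \<cdot> ?L" .
  have "of_nat (Suc (Suc n)) \<cdot> (extension (Suc (Suc n)) ;; \<Delta>B (Suc n) 1)
      = ?L ;; (nablaB (Suc n) 1 ;; \<Delta>B (Suc n) 1)"
    using comp_scale_left[OF _ extension_hom[of "Suc (Suc n)"] D', of "of_nat (Suc (Suc n))"]
      scale_extension_Suc[of "Suc n"] comp_assoc[OF L M D']
    by (simp del: of_nat_Suc One_nat_def extension.simps)
  \<comment> \<open>The identity summand gives one copy of \<open>?L\<close> and the swap summand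
    \<open>n+1\<close> copies, matching the factor \<open>n+2\<close> on the left.\<close>
  also have "\<dots> = ?L \<boxplus> ?s \<cdot> ?L"
    unfolding B.nabla_delta_Suc_1
    using comp_add_right[OF L id_hom S] S_eq id_right[OF L] by (simp add: B.obj tensor_obj)
  also have "\<dots> = of_nat (Suc (Suc n)) \<cdot> ?L"
    using scale_add_left[OF _ _ L, of 1 ?s] scale_one[OF L] by simp
  finally show ?case
    by (rule scale_inverse_eq[OF comp_hom[OF extension_hom D'] L, rotated]) simp
qed

text \<open>Dual induction. The recursion now exposes a multiplication followed by a
  comultiplication in \<open>A\<close>, so the bialgebra law is applied in the source instead of the
  target.\<close>

lemma nabla_1_extension: "nablaA n 1 ;; extension (Suc n) = extension n \<boxtimes> u ;; nablaB n 1"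
proof (induction n)
  case 0
  show ?case
    using extension_1 extension_nabla_0[OF u_hom] by (simp del: extension.simps)
next
  case (Suc n)
  let ?F = "extension (Suc n)" and ?s = "of_nat (Suc n)"
  let ?S = "\<Delta>A n 1 \<boxtimes> \<i>\<d> (A 1) ;; \<i>\<d> (A n) \<boxtimes> \<gamma> (A 1) (A 1) ;; nablaA n 1 \<boxtimes> \<i>\<d> (A 1)"
  note D = A.delta_1_hom[of "Suc n"] and Fu = tensor_hom[OF extension_hom[of "Suc n"] u_hom]
    and M = B.nabla_1_hom[of "Suc n"] and M' = A.nabla_1_hom[of "Suc n"]
  let ?L = "?F \<boxtimes> u ;; nablaB (Suc n) 1"
  have L: "?L \<in> Hom C (A (Suc n) \<boxdot> A 1) (B (Suc (Suc n)))" by (rule comp_hom[OF Fu M])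
  have S: "?S \<in> Hom C (A (Suc n) \<boxdot> A 1) (A (Suc n) \<boxdot> A 1)"
    by (rule A.swap_summand_hom)
  have "?S ;; ?L = (?s \<cdot> ?F) \<boxtimes> u ;; nablaB (Suc n) 1"
    unfolding scale_extension_Suc
    by (rule mul_step[OF M B.nabla_1_hom B.nabla_swap_last_two extension_hom extension_hom u_hom
          A.delta_1_hom A.nabla_1_hom Suc])
  also have "\<dots> = ?s \<cdot> ?L"
    using tensor_scale_left[OF _ extension_hom[of "Suc n"] u_hom, of ?s] comp_scale_left[OF _ Fu M, of ?s]
    by (simp del: of_nat_Suc One_nat_def extension.simps)
  finally have S_eq: "?S ;; ?L = ?s \<cdot> ?L" .
  have "of_nat (Suc (Suc n)) \<cdot> (nablaA (Suc n) 1 ;; extension (Suc (Suc n)))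
      = nablaA (Suc n) 1 ;; \<Delta>A (Suc n) 1 ;; ?L"
    using comp_scale_right[OF _ M' extension_hom[of "Suc (Suc n)"], of "of_nat (Suc (Suc n))"]
      scale_extension_Suc[of "Suc n"] comp_assoc[OF M' D L] comp_assoc[OF D Fu M]
    by (simp del: of_nat_Suc One_nat_def extension.simps)
  also have "\<dots> = ?L \<boxplus> ?s \<cdot> ?L"
    unfolding A.nabla_delta_Suc_1
    using comp_add_left[OF id_hom S L] S_eq id_left[OF L] by (simp add: A.obj tensor_obj)
  also have "\<dots> = of_nat (Suc (Suc n)) \<cdot> ?L"
    using scale_add_left[OF _ _ L, of 1 ?s] scale_one[OF L] by simp
  finally show ?case
    by (rule scale_inverse_eq[OF comp_hom[OF M' extension_hom] L, rotated]) simp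
qed

lemma delta_extension: "\<Delta>A n p ;; extension n \<boxtimes> extension p = extension (n + p) ;; \<Delta>B n p"
proof (induction p)
  case 0
  show ?case using delta_extension_0[OF extension_hom] by (simp del: extension.simps)
next
  case (Suc p)
  \<comment> \<open>The wanted equation for index \<open>p+1\<close>, followed on both sides by a
    map that \<open>delta_1_cancel\<close> removes in \<open>B\<close>.\<close>
  have "extension (Suc (n + p)) ;; \<Delta>B n (Suc p) ;; \<i>\<d> (B n) \<boxtimes> \<Delta>B p 1
      = \<Delta>A n (Suc p) ;; extension n \<boxtimes> extension (Suc p) ;; \<i>\<d> (B n) \<boxtimes> \<Delta>B p 1"
    using A.delta_coassoc[of n p 1] B.delta_coassoc[of n p 1]
    by (intro comul_extend[OF extension_hom A.delta_1_hom B.delta_1_hom extension_hom u_hom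
          extension_delta_1 A.delta_hom B.delta_hom extension_hom extension_hom Suc[symmetric]
          A.delta_Suc_hom B.delta_Suc_hom A.delta_1_hom B.delta_1_hom extension_hom extension_delta_1])
      (simp_all del: One_nat_def add: Suc_eq_plus1[symmetric])
  from B.delta_1_cancel[OF comp_hom[OF extension_hom B.delta_Suc_hom]
      comp_hom[OF A.delta_Suc_hom tensor_hom[OF extension_hom extension_hom]] this]
  show ?case
    by (simp del: extension.simps)
qed

lemma extension_nabla: "extension n \<boxtimes> extension p ;; nablaB n p = nablaA n p ;; extension (n + p)"
proof (induction p)
  case 0
  show ?case using extension_0_nabla[OF extension_hom] by (simp del: extension.simps)
next
  case (Suc p)
  \<comment> \<open>The factor to be cancelled now comes first, so \<open>nabla_1_cancel\<close> is
    used in \<open>A\<close>.\<close>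
  have "\<i>\<d> (A n) \<boxtimes> nablaA p 1 ;; (nablaA n (Suc p) ;; extension (Suc (n + p)))
      = \<i>\<d> (A n) \<boxtimes> nablaA p 1 ;; (extension n \<boxtimes> extension (Suc p) ;; nablaB n (Suc p))"
    using A.nabla_assoc[of n p 1] B.nabla_assoc[of n p 1]
    by (intro mul_extend[OF extension_hom A.nabla_1_hom B.nabla_1_hom extension_hom u_hom
          nabla_1_extension A.nabla_hom B.nabla_hom extension_hom extension_hom Suc[symmetric]
          A.nabla_Suc_hom B.nabla_Suc_hom A.nabla_1_hom B.nabla_1_hom extension_hom nabla_1_extension])
      (simp_all del: One_nat_def add: Suc_eq_plus1[symmetric])
  from A.nabla_1_cancel[OF comp_hom[OF A.nabla_Suc_hom extension_hom]
      comp_hom[OF tensor_hom[OF extension_hom extension_hom] B.nabla_Suc_hom] this]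
  show ?case
    by (simp del: extension.simps)
qed

lemma bimonoid_morphism_extension:
  "bimonoid_morphism C (A, nablaA, \<Delta>A, \<eta>A, \<epsilon>A) (B, nablaB, \<Delta>B, \<eta>B, \<epsilon>B) extension"
  by (simp only: bimonoid_morphism.simps extension_hom eta_extension_0 extension_0_eps
      extension_nabla delta_extension simp_thms)

end

section \<open>Morphisms are determined by their degree 1 component\<close>

lemma (in nonneg_rat_linear_smc) bimonoid_morphism_eqI:
  assumes M: "M \<in> binomial_bimonoids C" and N: "N \<in> binomial_bimonoids C"
    and f: "bimonoid_morphism C M N f" and g: "bimonoid_morphism C M N g" and eq: "f 1 = g 1"
  shows "f = g"
proof
  fix n
  obtain A mA dA uA eA where M_eq: "M = (A, mA, dA, uA, eA)" by (cases M)
  obtain B mB dB uB eB where N_eq: "N = (B, mB, dB, uB, eB)" by (cases N)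
  interpret B: binomial_bimonoid C B mB dB uB eB
    using N by (simp add: N_eq binomial_bimonoids_def)
  \<comment> \<open>Compatibility with the counits fixes \<open>h 0 ;; eB\<close>, and composing
    with \<open>uB\<close> recovers \<open>h 0\<close>, as \<open>eB ;; uB\<close> is an
    identity.\<close>
  have zero: "h 0 = eA ;; uB" if h: "bimonoid_morphism C M N h" for h
  proof -
    have "h 0 \<in> Hom C (A 0) (B 0)" "h 0 ;; eB = eA" using h by (auto simp: M_eq N_eq)
    then show ?thesis
      using comp_assoc[OF _ B.eps_hom B.eta_hom, of "h 0" "A 0"] by (simp add: B.eps_eta id_right)
  qed
  \<comment> \<open>Compatibility with \<open>dA n 1\<close>, followed by \<open>mB n 1\<close>: the
    composite \<open>dB n 1 ;; mB n 1\<close> is \<open>n+1\<close> times the identity. Hence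
    \<open>h\<close> satisfies the recursion of \<open>extension\<close>.\<close>
  have rec: "of_nat (Suc n) \<cdot> h (Suc n) = dA n 1 ;; h n \<boxtimes> h 1 ;; mB n 1"
    if h: "bimonoid_morphism C M N h" for h n
  proof -
    have hom: "h (Suc n) \<in> Hom C (A (Suc n)) (B (Suc n))" using h by (auto simp: M_eq N_eq)
    have "dA n 1 ;; h n \<boxtimes> h 1 = h (n + 1) ;; dB n 1"
      using h by (simp only: M_eq N_eq bimonoid_morphism.simps)
    then show ?thesis
      using comp_assoc[OF hom B.delta_1_hom B.nabla_1_hom] B.delta_1_nabla_1[of n]
        comp_scale_right[OF _ hom id_hom[OF B.obj], of "of_nat (Suc n)"] id_right[OF hom]
      by (simp del: of_nat_Suc)
  qed
  have hom: "f n \<in> Hom C (A n) (B n)" "g n \<in> Hom C (A n) (B n)" for n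
    using f g by (auto simp: M_eq N_eq)
  show "f n = g n"
  proof (induction n)
    case 0
    show ?case using zero[OF f] zero[OF g] by simp
  next
    case (Suc n)
    then have "of_nat (Suc n) \<cdot> f (Suc n) = of_nat (Suc n) \<cdot> g (Suc n)"
      using rec[OF f] rec[OF g] eq by simp
    then show ?case by (rule scale_inverse_eq[OF hom, rotated]) simp
  qed
qed

section \<open>The isomorphism of bimonoids\<close>

theorem corollary60:
  fixes C :: "('o, 'm) linear_category"
    and A B :: "nat \<Rightarrow> 'o"
    and nablaA \<Delta>A nablaB \<Delta>B :: "nat \<Rightarrow> nat \<Rightarrow> 'm"
    and \<eta>A \<epsilon>A \<eta>B \<epsilon>B :: "'m"
  assumes "nonneg_rat_linear_smc C"
    and "binomial_bimonoid C A nablaA \<Delta>A \<eta>A \<epsilon>A"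
    and "binomial_bimonoid C B nablaB \<Delta>B \<eta>B \<epsilon>B"
    and "isomorphic (graded_category C) A B"
  shows "isomorphic (binomial_bimonoid_category C)
    (A, nablaA, \<Delta>A, \<eta>A, \<epsilon>A) (B, nablaB, \<Delta>B, \<eta>B, \<epsilon>B)"
proof -
  interpret nonneg_rat_linear_smc C by fact
  let ?A = "(A, nablaA, \<Delta>A, \<eta>A, \<epsilon>A)" and ?B = "(B, nablaB, \<Delta>B, \<eta>B, \<epsilon>B)"
  have M: "?A \<in> binomial_bimonoids C" "?B \<in> binomial_bimonoids C"
    using assms(2,3) by (simp_all add: binomial_bimonoids_def)
  \<comment> \<open>These are the degree 1 components of the graded isomorphism and of its
    inverse.\<close>
  obtain u v where u: "u \<in> Hom C (A 1) (B 1)" and v: "v \<in> Hom C (B 1) (A 1)"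
    and uv: "u ;;\<^bsub>C\<^esub> v = \<i>\<d>\<^bsub>C\<^esub> (A 1)" "v ;;\<^bsub>C\<^esub> u = \<i>\<d>\<^bsub>C\<^esub> (B 1)"
  proof -
    obtain f g where "f \<in> Hom (graded_category C) A B" "g \<in> Hom (graded_category C) B A"
      and "f ;;\<^bsub>graded_category C\<^esub> g = \<i>\<d>\<^bsub>graded_category C\<^esub> A"
        "g ;;\<^bsub>graded_category C\<^esub> f = \<i>\<d>\<^bsub>graded_category C\<^esub> B"
      using assms(4) unfolding isomorphic_def by blast
    then show ?thesis
      by (intro that[of "f 1" "g 1"]) (simp_all add: graded_category_def fun_eq_iff del: One_nat_def)
  qed
  interpret F: binomial_extension C A nablaA \<Delta>A \<eta>A \<epsilon>A B nablaB \<Delta>B \<eta>B \<epsilon>B u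
    using assms(1-3) u by (simp add: binomial_extension_def binomial_extension_axioms_def)
  interpret G: binomial_extension C B nablaB \<Delta>B \<eta>B \<epsilon>B A nablaA \<Delta>A \<eta>A \<epsilon>A v
    using assms(1-3) v by (simp add: binomial_extension_def binomial_extension_axioms_def)
  note F = F.bimonoid_morphism_extension and G = G.bimonoid_morphism_extension
  \<comment> \<open>Both sides are endomorphisms of the bimonoid on \<open>A\<close>, and in degree
    1 they agree because \<open>u ;; v\<close> is the identity; uniqueness gives equality in every
    degree.\<close>
  have "(\<lambda>n. F.extension n ;;\<^bsub>C\<^esub> G.extension n) = (\<lambda>n. \<i>\<d>\<^bsub>C\<^esub> (A n))"
    using bimonoid_morphism_eqI[OF M(1,1) bimonoid_morphism_comp[OF M(1,2,1) F G]
        bimonoid_morphism_id[OF M(1)]] uv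
    by (simp only: F.extension_1 G.extension_1 fst_conv)
  moreover have "(\<lambda>n. G.extension n ;;\<^bsub>C\<^esub> F.extension n) = (\<lambda>n. \<i>\<d>\<^bsub>C\<^esub> (B n))"
    using bimonoid_morphism_eqI[OF M(2,2) bimonoid_morphism_comp[OF M(2,1,2) G F]
        bimonoid_morphism_id[OF M(2)]] uv
    by (simp only: F.extension_1 G.extension_1 fst_conv)
  ultimately show ?thesis
    unfolding isomorphic_def binomial_bimonoid_category_def
    using M F G by (auto simp del: bimonoid_morphism.simps)
qed

end
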